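(* Let $d\in\{1,2,3\}$, let $h>0$ be the mesh size of a uniform cell-centered $d$-dimensional rectangular grid, and let $k>0$, $\epsilon>0$, $\alpha>0$ be real numbers. Let $\Delta_h$ be the standard second-order centered-difference discrete Laplacian with discrete homogeneous Neumann boundary conditions, acting componentwise on $\mathbb{R}^3$-valued grid functions. Then for any given $\mathbb{R}^3$-valued grid functions $\boldsymbol{p}_h$ and $\hat{\boldsymbol{m}}_h$, there is exactly one $\mathbb{R}^3$-valued grid function $\boldsymbol{m}_h$ (satisfying the discrete homogeneous Neumann boundary condition) such that $$2\boldsymbol{m}_h + k\epsilon\, \hat{\boldsymbol{m}}_h \times \Delta_h \boldsymbol{m}_h + \alpha k \epsilon\, \hat{\boldsymbol{m}}_h \times \big(\hat{\boldsymbol{m}}_h \times \Delta_h \boldsymbol{m}_h\big) = \boldsymbol{p}_h$$ at every grid point, where $\times$ is the pointwise cross product in $\mathbb{R}^3$.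
   Context: Grid (written for $d=3$; for $d=1,2$ the superfluous indices are dropped): let $N_x,N_y,N_z\ge 1$ be integers. The grid points are $\left((i-\tfrac12)h,(j-\tfrac12)h,(l-\tfrac12)h\right)$ with $1\le i\le N_x$, $1\le j\le N_y$, $1\le l\le N_z$. A grid function $\boldsymbol{m}_h$ assigns to each grid point a vector $\boldsymbol{m}_{i,j,l}\in\mathbb{R}^3$. The discrete homogeneous Neumann boundary condition extends $\boldsymbol{m}_h$ to ghost points by $$\boldsymbol{m}_{0,j,l}=\boldsymbol{m}_{1,j,l},\quad \boldsymbol{m}_{N_x+1,j,l}=\boldsymbol{m}_{N_x,j,l},\quad \boldsymbol{m}_{i,0,l}=\boldsymbol{m}_{i,1,l},\quad \boldsymbol{m}_{i,N_y+1,l}=\boldsymbol{m}_{i,N_y,l},$$ $$\boldsymbol{m}_{i,j,0}=\boldsymbol{m}_{i,j,1},\quad \boldsymbol{m}_{i,j,N_z+1}=\boldsymbol{m}_{i,j,N_z}.$$ The discrete Laplacian at a grid point is $$\Delta_h\boldsymbol{m}_{i,j,l}=\frac{\boldsymbol{m}_{i+1,j,l}-2\boldsymbol{m}_{i,j,l}+\boldsymbol{m}_{i-1,j,l}}{h^2}+\frac{\boldsymbol{m}_{i,j+1,l}-2\boldsymbol{m}_{i,j,l}+\boldsymbol{m}_{i,j-1,l}}{h^2}+\frac{\boldsymbol{m}_{i,j,l+1}-2\boldsymbol{m}_{i,j,l}+\boldsymbol{m}_{i,j,l-1}}{h^2},$$ using the ghost values above where needed. The equation is the linear system solved at each time step (before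 projection onto unit length) of the semi-implicit Crank-Nicolson scheme for the Landau-Lifshitz-Gilbert equation, with $k$ the time step size, $\epsilon$ the exchange parameter and $\alpha$ the damping parameter. *)

theory Defs
  imports "HOL-Analysis.Analysis"
begin

unbundle cross3_syntax

text \<open>
  The index type \<open>'d\<close> enumerates the coordinate directions, so the dimension is \<open>CARD('d)\<close>, and
  \<open>N $ a\<close> is the number of cells in direction \<open>a\<close>. The cell centre with coordinates
  \<open>(i $ a - 1/2) * h\<close> is represented by its multi-index \<open>i\<close>.
\<close>

definition grid :: "int ^ 'd \<Rightarrow> (int ^ 'd) set" where
  "grid N = {i. \<forall>a. 1 \<le> i $ a \<and> i $ a \<le> N $ a}"

text \<open>Extensionality makes equality of grid functions mean equality of their values on the grid.\<close>

definition grid_functions :: "int ^ 'd \<Rightarrow> (int ^ 'd \<Rightarrow> real ^ 3) set" where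
  "grid_functions N = grid N \<rightarrow>\<^sub>E UNIV"

text \<open>
  Only indices in the grid and ghost indices, where exactly one component is \<open>0\<close> or \<open>N $ a + 1\<close>,
  matter below; see \<open>neumann_extension_grid\<close>, \<open>neumann_extension_lower\<close> and
  \<open>neumann_extension_upper\<close>.
\<close>

definition neumann_extension ::
    "int ^ 'd \<Rightarrow> (int ^ 'd \<Rightarrow> real ^ 3) \<Rightarrow> int ^ 'd \<Rightarrow> real ^ 3" where
  "neumann_extension N m i =
     m (\<chi> a. if i $ a = 0 then 1 else if i $ a = N $ a + 1 then N $ a else i $ a)"

definition discrete_laplacian ::
    "real \<Rightarrow> (int ^ 'd \<Rightarrow> real ^ 3) \<Rightarrow> int ^ 'd::finite \<Rightarrow> real ^ 3" where
  "discrete_laplacian h m i =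
     (\<Sum>a\<in>UNIV. (m (i + axis a 1) - 2 *\<^sub>R m i + m (i - axis a 1)) /\<^sub>R h\<^sup>2)"

lemma neumann_extension_grid:
  assumes "i \<in> grid N"
  shows "neumann_extension N m i = m i"
proof -
  have "i $ a \<noteq> 0 \<and> i $ a \<noteq> N $ a + 1" for a
    using assms by (force simp: grid_def dest: spec[of _ a])
  then show ?thesis
    by (simp add: neumann_extension_def)
qed

lemma neumann_extension_lower:
  fixes N :: "int ^ 'd::finite"
  assumes i: "i \<in> grid N" and "i $ a = 1"
  shows "neumann_extension N m (i - axis a 1) = m i"
proof -
  have "1 \<le> i $ b" "i $ b \<le> N $ b" for b
    using i by (auto simp: grid_def)
  then have "(\<chi> b. if (i - axis a 1) $ b = 0 then 1
      else if (i - axis a 1) $ b = N $ b + 1 then N $ b else (i - axis a 1) $ b) = i"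
    using assms(2) by (simp add: vec_eq_iff axis_def) (smt (verit))
  then show ?thesis
    by (simp add: neumann_extension_def)
qed

lemma neumann_extension_upper:
  fixes N :: "int ^ 'd::finite"
  assumes i: "i \<in> grid N" and "i $ a = N $ a"
  shows "neumann_extension N m (i + axis a 1) = m i"
proof -
  have "1 \<le> i $ b" "i $ b \<le> N $ b" for b
    using i by (auto simp: grid_def)
  then have "(\<chi> b. if (i + axis a 1) $ b = 0 then 1
      else if (i + axis a 1) $ b = N $ b + 1 then N $ b else (i + axis a 1) $ b) = i"
    using assms(2) by (simp add: vec_eq_iff axis_def) (smt (verit))
  then show ?thesis
    by (simp add: neumann_extension_def)
qed

end

theory Submission
  imports Defs "HOL-Library.Function_Algebras"
begin

text \<open>
  The scheme is a linear system on a finite-dimensional space, so it suffices that the homogeneous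
  system has only the trivial solution. Taking the inner product of the homogeneous equation with
  \<open>\<Delta>\<^sub>h m\<close> annihilates the precession term and turns the damping term into
  \<open>- \<alpha> k \<epsilon> \<bar>mhat \<times> \<Delta>\<^sub>h m\<bar>\<^sup>2\<close>. Summed over the grid, this contradicts
  \<open>\<Sum> m \<bullet> \<Delta>\<^sub>h m \<le> 0\<close> unless \<open>mhat \<times> \<Delta>\<^sub>h m = 0\<close> everywhere, and then the equation
  reads \<open>2 m = 0\<close>.
\<close>

section \<open>Linear algebra: injectivity gives surjectivity in finite dimension\<close>

lemma (in vector_space) linear_inj_on_span_surj:
  assumes lin: "Vector_Spaces.linear scale scale f" and "finite B"
    and sub: "f ` span B \<subseteq> span B" and inj: "inj_on f (span B)"
  shows "f ` span B = span B"
proof -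
  interpret f: Vector_Spaces.linear scale scale f by (rule lin)
  \<comment> \<open>\<open>B\<close> may be dependent, so a maximal independent subset
    \<open>C\<close> with the same span serves as a basis.\<close>
  obtain C where C: "C \<subseteq> B" "independent C" "B \<subseteq> span C"
    using maximal_independent_subset[of B] by blast
  have span: "span C = span B"
    using C by (meson span_mono span_minimal subspace_span subset_antisym)
  have "finite C" using C(1) \<open>finite B\<close> by (rule finite_subset)
  have ind: "independent (f ` C)"
    using C(2) inj unfolding span[symmetric] by (rule f.independent_injective_image)
  have "f ` C \<subseteq> span C"
    using sub span by (auto intro: span_base)
  have "card (f ` C) = card C"
    using inj span by (intro card_image) (metis inj_on_subset span_superset)
  \<comment> \<open>The image of \<open>C\<close> is independent, lies in \<open>span C\<close> and
    has as many elements as \<open>C\<close>. A point of \<open>C\<close> outside its span could be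
    added to it, giving an independent set in \<open>span C\<close> larger than the exchange bound
    allows.\<close>
  have "x \<in> span (f ` C)" if "x \<in> C" for x
  proof (rule ccontr)
    assume x: "x \<notin> span (f ` C)"
    then have "x \<notin> f ` C" using span_base by blast
    moreover have "card (insert x (f ` C)) \<le> card C"
      using independent_span_bound[OF \<open>finite C\<close> independent_insertI[OF x ind]]
        \<open>f ` C \<subseteq> span C\<close> span_base[OF that] by simp
    ultimately show False
      using \<open>finite C\<close> \<open>card (f ` C) = card C\<close> by simp
  qed
  then have "span C \<subseteq> span (f ` C)"
    by (intro span_minimal subspace_span subsetI)
  then have "span B \<subseteq> f ` span B"
    by (simp add: f.span_image span)
  with sub show ?thesis by blast
qed

lemma vector_space_fun: "vector_space (\<lambda>c f x. c *\<^sub>R (f x :: 'b::real_vector))"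
  by unfold_locales (auto simp: fun_eq_iff algebra_simps)

lemma sum_fun_apply: "(\<Sum>i\<in>A. f i) x = (\<Sum>i\<in>A. f i x :: 'b::comm_monoid_add)"
  by (induction A rule: infinite_finite_induct) auto

text \<open>The space of all functions on the index type may be infinite-dimensional. The argument
  is therefore confined to the functions vanishing outside the finite set \<open>A\<close>, a
  finite-dimensional subspace that \<open>T\<close> maps into itself.\<close>

lemma finitely_supported_operator_surj:
  fixes T :: "('a \<Rightarrow> 'b::euclidean_space) \<Rightarrow> 'a \<Rightarrow> 'b"
  assumes "finite A"
    and add: "\<And>f g x. T (\<lambda>x. f x + g x) x = T f x + T g x"
    and scale: "\<And>c f x. T (\<lambda>x. c *\<^sub>R f x) x = c *\<^sub>R T f x"
    and supp: "\<And>f x. x \<notin> A \<Longrightarrow> T f x = 0"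
    and inj: "\<And>f. \<lbrakk>\<And>x. x \<notin> A \<Longrightarrow> f x = 0; \<And>x. T f x = 0\<rbrakk> \<Longrightarrow> f = (\<lambda>x. 0)"
    and p: "\<And>x. x \<notin> A \<Longrightarrow> p x = 0"
  shows "\<exists>f. T f = p"
proof -
  interpret F: vector_space "\<lambda>c f x. c *\<^sub>R (f x :: 'b)"
    by (rule vector_space_fun)
  have lin: "Vector_Spaces.linear (\<lambda>c f x. c *\<^sub>R f x) (\<lambda>c f x. c *\<^sub>R f x) T"
    using add scale
    by (auto simp add: fun_eq_iff Vector_Spaces.linear_def F.vector_space_axioms module_hom_def
        module_hom_axioms_def F.module_axioms plus_fun_def)
  interpret T: Vector_Spaces.linear "\<lambda>c f x. c *\<^sub>R f x" "\<lambda>c f x. c *\<^sub>R f x" T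
    by (rule lin)
  \<comment> \<open>Basis vectors concentrated at single points of \<open>A\<close>; expanding each
    value of a function in \<open>Basis\<close> shows that they span \<open>?S\<close>.\<close>
  define B where "B = (\<lambda>(i, b) j. if j = i then b else (0::'b)) ` (A \<times> Basis)"
  let ?S = "{f. \<forall>x. x \<notin> A \<longrightarrow> f x = (0::'b)}"
  have "finite B" using \<open>finite A\<close> by (simp add: B_def)
  have sub: "F.subspace ?S"
    by (auto simp: F.subspace_def)
  have span: "F.span B = ?S"
  proof
    show "F.span B \<subseteq> ?S"
      using sub by (rule F.span_minimal[rotated]) (auto simp: B_def)
    show "?S \<subseteq> F.span B"
    proof
      fix f assume "f \<in> ?S"
      have "(\<Sum>b\<in>Basis. (f i \<bullet> b) *\<^sub>R (if x = i then b else 0)) = (if x = i then f i else 0)" for i x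
        by (simp add: euclidean_representation)
      with \<open>f \<in> ?S\<close> have "f = (\<Sum>i\<in>A. \<Sum>b\<in>Basis. (\<lambda>x. (f i \<bullet> b) *\<^sub>R (if x = i then b else 0)))"
        using \<open>finite A\<close> by (simp add: fun_eq_iff sum_fun_apply)
      also have "\<dots> \<in> F.span B"
        by (intro F.span_sum F.span_scale F.span_base) (force simp: B_def)
      finally show "f \<in> F.span B" .
    qed
  qed
  have "inj_on T (F.span B)"
    unfolding span T.inj_on_iff_eq_0[OF sub]
  proof (intro ballI impI)
    fix f assume "f \<in> ?S" "T f = 0"
    then have "f x = 0" if "x \<notin> A" for x using that by simp
    moreover have "T f x = 0" for x using \<open>T f = 0\<close> by simp
    ultimately show "f = 0"
      unfolding zero_fun_def by (rule inj)
  qed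
  moreover have "T ` ?S \<subseteq> ?S"
    using supp by auto
  ultimately have "T ` ?S = ?S"
    using F.linear_inj_on_span_surj[OF lin \<open>finite B\<close>] unfolding span by simp
  moreover have "p \<in> ?S" using p by simp
  ultimately have "p \<in> T ` ?S" by (simp only:)
  then show ?thesis by (auto simp only: image_iff)
qed

section \<open>The grid, reflected steps and the discrete Laplacian\<close>

lemma finite_grid: "finite (grid (N :: int ^ 'd::finite))"
proof (rule finite_imageD)
  show "finite (($) ` grid N)"
    by (rule finite_subset[of _ "PiE UNIV (\<lambda>a. {1..N $ a})"])
      (auto simp: grid_def intro!: finite_PiE)
qed (auto simp: inj_on_def vec_eq_iff)

text \<open>A step off the grid is reflected to its starting point by the boundary condition.\<close>

definition step_up :: "int ^ 'd \<Rightarrow> 'd \<Rightarrow> int ^ 'd \<Rightarrow> int ^ 'd::finite" where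
  "step_up N a i = (if i $ a = N $ a then i else i + axis a 1)"

definition step_down :: "'d \<Rightarrow> int ^ 'd \<Rightarrow> int ^ 'd::finite" where
  "step_down a i = (if i $ a = 1 then i else i - axis a 1)"

lemma step_up_grid: "i \<in> grid N \<Longrightarrow> step_up N a i \<in> grid N"
  unfolding grid_def step_up_def axis_def by (simp, smt (verit))

lemma step_down_grid: "i \<in> grid N \<Longrightarrow> step_down a i \<in> grid N"
  unfolding grid_def step_down_def axis_def by (simp, smt (verit))

lemma neumann_extension_step_up:
  "i \<in> grid N \<Longrightarrow> neumann_extension N m (i + axis a 1) = m (step_up N a i)"
  using step_up_grid[of i N a]
  by (auto simp: step_up_def neumann_extension_upper neumann_extension_grid split: if_splits)

lemma neumann_extension_step_down:
  "i \<in> grid N \<Longrightarrow> neumann_extension N m (i - axis a 1) = m (step_down a i)"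
  using step_down_grid[of i N a]
  by (auto simp: step_down_def neumann_extension_lower neumann_extension_grid split: if_splits)

text \<open>Eliminates the ghost points: only values on the grid remain, so sums over the grid can
  be rearranged.\<close>

lemma discrete_laplacian_grid:
  assumes "i \<in> grid N"
  shows "discrete_laplacian h (neumann_extension N m) i =
    (\<Sum>a\<in>UNIV. (m (step_up N a i) - 2 *\<^sub>R m i + m (step_down a i)) /\<^sub>R h\<^sup>2)"
  using assms
  by (simp add: discrete_laplacian_def neumann_extension_step_up neumann_extension_step_down
      neumann_extension_grid)

lemma discrete_laplacian_cong:
  assumes "i \<in> grid N" and "\<And>j. j \<in> grid N \<Longrightarrow> m j = m' j"
  shows "discrete_laplacian h (neumann_extension N m) i =
    discrete_laplacian h (neumann_extension N m') i"
  using assms by (simp add: discrete_laplacian_grid step_up_grid step_down_grid)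

lemma discrete_laplacian_add:
  "discrete_laplacian h (neumann_extension N (\<lambda>i. m i + m' i)) i =
    discrete_laplacian h (neumann_extension N m) i + discrete_laplacian h (neumann_extension N m') i"
  by (simp add: discrete_laplacian_def neumann_extension_def flip: sum.distrib)
    (simp add: algebra_simps)

lemma discrete_laplacian_scale:
  "discrete_laplacian h (neumann_extension N (\<lambda>i. c *\<^sub>R m i)) i =
    c *\<^sub>R discrete_laplacian h (neumann_extension N m) i"
  by (simp add: discrete_laplacian_def neumann_extension_def scaleR_sum_right)
    (simp add: algebra_simps)

text \<open>Compared with one visit per cell, \<open>step_up\<close> counts the top layer in
  direction \<open>a\<close> once more and the bottom layer once less; \<open>step_down\<close> does
  the opposite, so the two corrections cancel.\<close>

lemma sum_step_up_step_down:
  fixes F :: "int ^ 'd::finite \<Rightarrow> real"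
  shows "(\<Sum>i\<in>grid N. F (step_up N a i) + F (step_down a i)) = 2 * (\<Sum>i\<in>grid N. F i)"
proof -
  let ?U = "{i \<in> grid N. i $ a \<noteq> N $ a}" and ?D = "{i \<in> grid N. i $ a \<noteq> 1}"
  have "(\<Sum>i\<in>grid N. F (step_up N a i) - F i) = (\<Sum>i\<in>?U. F (i + axis a 1) - F i)"
    by (rule sum.mono_neutral_cong_right) (auto simp: finite_grid step_up_def)
  \<comment> \<open>A shift by one cell maps the cells off the top layer bijectively to those off
    the bottom layer.\<close>
  also have "\<dots> = (\<Sum>i\<in>?D. F i - F (i - axis a 1))"
    by (rule sum.reindex_bij_witness[of _ "\<lambda>i. i - axis a 1" "\<lambda>i. i + axis a 1"])
      (auto simp: grid_def axis_def, (smt (verit))+)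
  also have "\<dots> = (\<Sum>i\<in>grid N. F i - F (step_down a i))"
    by (rule sum.mono_neutral_cong_left) (auto simp: finite_grid step_down_def)
  finally show ?thesis
    by (simp add: sum_subtractf sum.distrib)
qed

text \<open>In place of summation by parts, Young's inequality bounds each product with a neighbour
  by squares. By \<open>sum_step_up_step_down\<close>, the neighbours' squares then cancel exactly
  against the central term.\<close>

lemma sum_inner_discrete_laplacian_nonpos:
  fixes m :: "int ^ 'd::finite \<Rightarrow> real ^ 3"
  shows "(\<Sum>i\<in>grid N. m i \<bullet> discrete_laplacian h (neumann_extension N m) i) \<le> 0"
proof -
  have "(\<Sum>i\<in>grid N. m i \<bullet> (m (step_up N a i) - 2 *\<^sub>R m i + m (step_down a i))) \<le> 0" for a
  proof -
    have inner: "x \<bullet> y \<le> (x \<bullet> x + y \<bullet> y) / 2" for x y :: "real ^ 3"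
      using inner_ge_zero[of "x - y"] by (simp add: inner_diff inner_commute field_simps)
    have "(\<Sum>i\<in>grid N. m i \<bullet> (m (step_up N a i) - 2 *\<^sub>R m i + m (step_down a i))) \<le>
      (\<Sum>i\<in>grid N. (m (step_up N a i) \<bullet> m (step_up N a i)
        + m (step_down a i) \<bullet> m (step_down a i)) / 2 - m i \<bullet> m i)"
    proof (rule sum_mono)
      fix i
      show "m i \<bullet> (m (step_up N a i) - 2 *\<^sub>R m i + m (step_down a i)) \<le>
        (m (step_up N a i) \<bullet> m (step_up N a i)
          + m (step_down a i) \<bullet> m (step_down a i)) / 2 - m i \<bullet> m i"
        using inner[of "m i" "m (step_up N a i)"] inner[of "m i" "m (step_down a i)"]
        by (simp add: inner_add_right inner_diff_right field_simps)
    qed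
    also have "\<dots> = 0"
      using sum_step_up_step_down[of "\<lambda>i. m i \<bullet> m i" N a]
      by (simp add: sum_subtractf flip: sum_divide_distrib)
    finally show ?thesis .
  qed
  then have "(\<Sum>a\<in>UNIV. (\<Sum>i\<in>grid N.
      m i \<bullet> (m (step_up N a i) - 2 *\<^sub>R m i + m (step_down a i))) / h\<^sup>2) \<le> 0"
    by (intro sum_nonpos[of UNIV] divide_nonpos_nonneg) simp_all
  also have "(\<Sum>a\<in>UNIV. (\<Sum>i\<in>grid N.
      m i \<bullet> (m (step_up N a i) - 2 *\<^sub>R m i + m (step_down a i))) / h\<^sup>2) =
    (\<Sum>i\<in>grid N. \<Sum>a\<in>UNIV. m i \<bullet> ((m (step_up N a i) - 2 *\<^sub>R m i + m (step_down a i)) /\<^sub>R h\<^sup>2))"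
    by (subst sum.swap) (simp add: divide_inverse_commute sum_distrib_left)
  also have "\<dots> = (\<Sum>i\<in>grid N. m i \<bullet> discrete_laplacian h (neumann_extension N m) i)"
    by (simp add: discrete_laplacian_grid inner_sum_right)
  finally show ?thesis .
qed

section \<open>The operator of the scheme and its trivial kernel\<close>

lemma inner_double_cross: "v \<bullet> (w \<times> (w \<times> v)) = - ((w \<times> v) \<bullet> (w \<times> v))"
  \<comment> \<open>The scalar triple product is cyclic, and swapping the factors of the remaining
    cross product gives the sign.\<close>
  by (metis cross_skew cross_triple inner_commute inner_minus_left)

text \<open>\<beta> is the precession coefficient \<open>k * \<epsilon>\<close> and \<gamma> the
  damping coefficient \<open>\<alpha> * k * \<epsilon>\<close>.\<close>

definition llg_operator ::
    "int ^ 'd \<Rightarrow> real \<Rightarrow> real \<Rightarrow> real \<Rightarrow> (int ^ 'd \<Rightarrow> real ^ 3) \<Rightarrow> (int ^ 'd \<Rightarrow> real ^ 3)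
      \<Rightarrow> int ^ 'd::finite \<Rightarrow> real ^ 3" where
  "llg_operator N h \<beta> \<gamma> w m i = 2 *\<^sub>R m i
    + \<beta> *\<^sub>R (w i \<times> discrete_laplacian h (neumann_extension N m) i)
    + \<gamma> *\<^sub>R (w i \<times> (w i \<times> discrete_laplacian h (neumann_extension N m) i))"

text \<open>Allows a solution to be changed off the grid, in particular to be made
  extensional.\<close>

lemma llg_operator_cong:
  assumes "i \<in> grid N" and "\<And>j. j \<in> grid N \<Longrightarrow> m j = m' j"
  shows "llg_operator N h \<beta> \<gamma> w m i = llg_operator N h \<beta> \<gamma> w m' i"
  using discrete_laplacian_cong[OF assms] assms by (simp add: llg_operator_def)

lemma llg_operator_add:
  "llg_operator N h \<beta> \<gamma> w (\<lambda>i. m i + m' i) i =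
    llg_operator N h \<beta> \<gamma> w m i + llg_operator N h \<beta> \<gamma> w m' i"
  by (simp add: llg_operator_def discrete_laplacian_add cross_add_right algebra_simps)

lemma llg_operator_scale:
  "llg_operator N h \<beta> \<gamma> w (\<lambda>i. c *\<^sub>R m i) i = c *\<^sub>R llg_operator N h \<beta> \<gamma> w m i"
  by (simp add: llg_operator_def discrete_laplacian_scale cross_mult_right algebra_simps)

lemma llg_operator_eq_0D:
  assumes "\<gamma> > 0" and eq: "\<And>i. i \<in> grid N \<Longrightarrow> llg_operator N h \<beta> \<gamma> w m i = 0" and "i \<in> grid N"
  shows "m i = 0"
proof -
  let ?L = "discrete_laplacian h (neumann_extension N m)"
  let ?c = "\<lambda>i. (w i \<times> ?L i) \<bullet> (w i \<times> ?L i)"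
  \<comment> \<open>This identity is pointwise; the sign of its right-hand side is controlled only
    after summation over the grid.\<close>
  have "\<gamma> * ?c i = 2 * (m i \<bullet> ?L i)" if "i \<in> grid N" for i
  proof -
    have "?L i \<bullet> llg_operator N h \<beta> \<gamma> w m i = 0"
      using eq[OF that] by simp
    then show ?thesis
      by (simp add: llg_operator_def inner_add_right inner_double_cross dot_cross_self inner_commute)
  qed
  then have "\<gamma> * (\<Sum>i\<in>grid N. ?c i) = 2 * (\<Sum>i\<in>grid N. m i \<bullet> ?L i)"
    by (simp add: sum_distrib_left)
  also have "\<dots> \<le> 0"
    using sum_inner_discrete_laplacian_nonpos[of m h N] by simp
  finally have "(\<Sum>i\<in>grid N. ?c i) \<le> 0"
    using \<open>\<gamma> > 0\<close> by (simp add: mult_le_0_iff)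
  then have "(\<Sum>i\<in>grid N. ?c i) = 0"
    by (intro antisym sum_nonneg) auto
  then have "?c i = 0"
    using \<open>i \<in> grid N\<close> by (simp add: sum_nonneg_eq_0_iff finite_grid)
  then have "w i \<times> ?L i = 0" by simp
  with eq[OF \<open>i \<in> grid N\<close>] show ?thesis
    by (simp add: llg_operator_def)
qed

theorem theorem3:
  fixes N :: "int ^ 'd::finite"
    and h k \<epsilon> \<alpha> :: real
    and p mhat :: "int ^ 'd \<Rightarrow> real ^ 3"
  assumes "CARD('d) \<in> {1, 2, 3}"
    and "\<And>a. N $ a \<ge> 1"
    and "h > 0" and "k > 0" and "\<epsilon> > 0" and "\<alpha> > 0"
    and "p \<in> grid_functions N" and "mhat \<in> grid_functions N"
  shows "\<exists>!m. m \<in> grid_functions N \<and>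
    (\<forall>i\<in>grid N.
      2 *\<^sub>R m i
      + (k * \<epsilon>) *\<^sub>R (mhat i \<times> discrete_laplacian h (neumann_extension N m) i)
      + (\<alpha> * k * \<epsilon>) *\<^sub>R
          (mhat i \<times> (mhat i \<times> discrete_laplacian h (neumann_extension N m) i))
      = p i)"
proof -
  let ?T = "llg_operator N h (k * \<epsilon>) (\<alpha> * k * \<epsilon>) mhat"
  have pos: "\<alpha> * k * \<epsilon> > 0" using assms by simp
  \<comment> \<open>Extensional functions take the value \<open>undefined\<close> off the grid and
    form no evident linear space, so both sides are cut off to zero there.\<close>
  have "\<exists>f. (\<lambda>i. if i \<in> grid N then ?T f i else 0) = (\<lambda>i. if i \<in> grid N then p i else 0)"
  proof (rule finitely_supported_operator_surj[OF finite_grid[of N]])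
    fix f :: "int ^ 'd \<Rightarrow> real ^ 3"
    assume "\<And>i. i \<notin> grid N \<Longrightarrow> f i = 0"
      and "\<And>i. (if i \<in> grid N then ?T f i else 0) = 0"
    then show "f = (\<lambda>i. 0)"
      using llg_operator_eq_0D[OF pos, of N h _ mhat f] by (metis ext)
  qed (auto simp: llg_operator_add llg_operator_scale)
  then obtain f where f: "\<And>i. i \<in> grid N \<Longrightarrow> ?T f i = p i"
    by (metis (full_types))
  have "\<exists>!m. m \<in> grid_functions N \<and> (\<forall>i\<in>grid N. ?T m i = p i)"
  proof (rule ex1I)
    \<comment> \<open>The values of \<open>f\<close> off the grid are arbitrary, so \<open>f\<close>
      is restricted to become a grid function.\<close>
    have "?T (restrict f (grid N)) i = p i" if "i \<in> grid N" for i
      using f[OF that] llg_operator_cong[OF that, of "restrict f (grid N)" f] by simp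
    then show "restrict f (grid N) \<in> grid_functions N \<and>
        (\<forall>i\<in>grid N. ?T (restrict f (grid N)) i = p i)"
      by (simp add: grid_functions_def)
  next
    fix m assume m: "m \<in> grid_functions N \<and> (\<forall>i\<in>grid N. ?T m i = p i)"
    \<comment> \<open>The difference is written as a sum with a multiple to fit the two linearity
      lemmas. The kernel lemma yields equality on the grid, and extensionality settles the other
      indices.\<close>
    have "?T (\<lambda>i. m i + (-1) *\<^sub>R f i) i = 0" if "i \<in> grid N" for i
      using m f that by (simp only: llg_operator_add llg_operator_scale) simp
    then have "m i + (-1) *\<^sub>R f i = 0" if "i \<in> grid N" for i
      using llg_operator_eq_0D[OF pos] that by blast
    then show "m = restrict f (grid N)"
      using m by (intro extensionalityI[of _ "grid N"]) (auto simp: grid_functions_def PiE_def)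
  qed
  then show ?thesis
    by (simp add: llg_operator_def)
qed

end
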